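(* Let $\delta\in(0,\tfrac12]$ and let $A\subseteq[0,\delta]$. Define $d_0:A\times A\to[0,\infty)$ by $d_0(x,y)=0$ if $x=y$ and $d_0(x,y)=\max\{x,y\}$ if $x\ne y$. Then $d_0$ is an ultrametric on $A$.
   Context: An ultrametric is a metric $d$ satisfying $d(x,z)\le\max\{d(x,y),d(y,z)\}$ for all $x,y,z$. *)

theory Defs
  imports "HOL-Analysis.Abstract_Metric_Spaces"
begin

locale Ultrametric_space = Metric_space +
  assumes ultrametric:
    "\<And>x y z. \<lbrakk>x \<in> M; y \<in> M; z \<in> M\<rbrakk> \<Longrightarrow> d x z \<le> max (d x y) (d y z)"

(* The function has domain A \<times> A. It is extended by 0 off the domain because the library
   locale Metric_space requires nonnegativity and symmetry of d on the whole type, not just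
   on the carrier (and max x y may be negative outside A). *)
definition d0 :: "real set \<Rightarrow> real \<Rightarrow> real \<Rightarrow> real" where
  "d0 A x y = (if x \<in> A \<and> y \<in> A then (if x = y then 0 else max x y) else 0)"

end

theory Submission
  imports Defs
begin

theorem proposition5p2:
  fixes \<delta> :: real and A :: "real set"
  assumes "\<delta> \<in> {0<..1/2}"
    and "A \<subseteq> {0..\<delta>}"
  shows "Ultrametric_space A (d0 A)"
proof -
  have nonneg: "0 \<le> x" if "x \<in> A" for x
    using assms(2) that by auto
  have d0_nonneg: "0 \<le> d0 A x y" for x y
    using nonneg[of x] nonneg[of y] by (auto simp: d0_def)
  \<comment> \<open>If \<open>x \<noteq> z\<close>, then \<open>y\<close> differs from at least one of them. If it differs from both,
    \<open>x\<close> is bounded by the distance from \<open>x\<close> to \<open>y\<close>, and \<open>z\<close> by that from \<open>y\<close> to \<open>z\<close>;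
    if it equals one of them, the two sides agree.\<close>
  have ultra: "d0 A x z \<le> max (d0 A x y) (d0 A y z)"
    if "x \<in> A" "y \<in> A" "z \<in> A" for x y z
    using that nonneg[of x] nonneg[of y] nonneg[of z] by (auto simp: d0_def)
  show ?thesis
  proof
    show "0 \<le> d0 A x y" for x y
      by (rule d0_nonneg)
    show "d0 A x y = d0 A y x" for x y
      by (simp add: d0_def max.commute)
    \<comment> \<open>Two distinct points of \<open>A\<close> cannot both be \<open>0\<close>, so the larger one is positive.\<close>
    show "d0 A x y = 0 \<longleftrightarrow> x = y" if "x \<in> A" "y \<in> A" for x y
      using that nonneg[of x] nonneg[of y] by (auto simp: d0_def max_def)
    \<comment> \<open>The maximum of two nonnegative distances is at most their sum.\<close>
    show "d0 A x z \<le> d0 A x y + d0 A y z" if "x \<in> A" "y \<in> A" "z \<in> A" for x y z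
      using ultra[OF that] d0_nonneg[of x y] d0_nonneg[of y z] by linarith
    show "d0 A x z \<le> max (d0 A x y) (d0 A y z)" if "x \<in> A" "y \<in> A" "z \<in> A" for x y z
      using that by (rule ultra)
  qed
qed

end
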